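(* Let $X$ be a real Banach space whose dual $X^*$ is strictly convex, and let $K$ be a cone in $X$ with vertex $v$. Let $K_P^{\perp}=\{x\in X:\ \langle J(x-v),v-z\rangle\ge 0\ \text{for all } z\in K\}$. Then: (a) $K_P^{\perp}$ is a cone with vertex at $v$ in $X$. (b) If $X$ is uniformly convex and uniformly smooth, then $K_P^{\perp}$ is closed. (c) If $X$ is uniformly convex and uniformly smooth and $K$ is closed and convex, then $K_P^{\perp}=P_K^{-1}(v)$, where $P_K^{-1}(v)=\{x\in X: P_K x=v\}$. Moreover, the following hold in general, that is, there exist a Banach space $X$ with strictly convex dual and a cone $K$ in $X$ with vertex $v$ for which: (d) $K_P^{\perp}$ is not convex; (e) $K\not\subseteq (K_P^{\perp})_P^{\perp}$; (f) $K$ and $K_P^{\perp}$ are not dual cones of each other, i.e. $K\ne (K_P^{\perp})_P^{\perp}$.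
   Context: $\langle\cdot,\cdot\rangle$ is the duality pairing between $X^*$ and $X$. The normalized duality mapping $J$ of $X$ assigns to $x\in X$ the functional $Jx\in X^*$ with $\langle Jx,x\rangle=\|Jx\|_{X^*}^2=\|x\|_X^2$; it is single-valued when $X^*$ is strictly convex. A cone with vertex $v$ is a set $K$ containing $v$ such that $v+t(x-v)\in K$ for all $x\in K$ and $t\ge 0$. For a cone $L$ in $X$ with vertex $v$, $L_P^{\perp}=\{x\in X:\langle J(x-v),v-z\rangle\ge 0\ \forall z\in L\}$ is the dual cone of $L$ with respect to the metric projection; in $(K_P^{\perp})_P^{\perp}$ the vertex used for the outer operation is the common vertex $v$. For $X$ uniformly convex and uniformly smooth and $C\subseteq X$ nonempty, closed and convex, the metric projection $P_C:X\to C$ is the map such that $\|x-P_Cx\|\le\|x-z\|$ for all $z\in C$. *)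

theory Defs
  imports "HOL-Analysis.Analysis"
begin

text \<open>
  A real Banach space is given here by a real vector space (a type of class \<open>real_vector\<close>)
  together with an explicit complete norm \<open>N\<close> on it, rather than by a type of class \<open>banach\<close>:
  existence of a Banach space with certain properties can then be expressed by quantifying
  over \<open>N\<close>, which is impossible for a class. The lemmas named \<open>*_norm_eq\<close> say that for the
  norm of a type of class \<open>banach\<close> (or \<open>real_normed_vector\<close>) these notions are those of the library.
\<close>

definition norm_fun :: "('a::real_vector \<Rightarrow> real) \<Rightarrow> bool" where
  "norm_fun N \<longleftrightarrow>
     (\<forall>x. N x = 0 \<longleftrightarrow> x = 0) \<and>
     (\<forall>x y. N (x + y) \<le> N x + N y) \<and>
     (\<forall>c x. N (c *\<^sub>R x) = \<bar>c\<bar> * N x)"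

definition dist_of :: "('a::real_vector \<Rightarrow> real) \<Rightarrow> 'a \<Rightarrow> 'a \<Rightarrow> real" where
  "dist_of N x y = N (x - y)"

definition banach_norm :: "('a::real_vector \<Rightarrow> real) \<Rightarrow> bool" where
  "banach_norm N \<longleftrightarrow> norm_fun N \<and> Metric_space.mcomplete UNIV (dist_of N)"

definition norm_closed :: "('a::real_vector \<Rightarrow> real) \<Rightarrow> 'a set \<Rightarrow> bool" where
  "norm_closed N S \<longleftrightarrow> closedin (Metric_space.mtopology UNIV (dist_of N)) S"

definition dual_space :: "('a::real_vector \<Rightarrow> real) \<Rightarrow> ('a \<Rightarrow> real) set" where
  "dual_space N = {f. linear f \<and> (\<exists>C. \<forall>x. \<bar>f x\<bar> \<le> C * N x)}"

definition dual_norm :: "('a::real_vector \<Rightarrow> real) \<Rightarrow> ('a \<Rightarrow> real) \<Rightarrow> real" where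
  "dual_norm N f = (SUP x\<in>{x. N x \<le> 1}. \<bar>f x\<bar>)"

definition strictly_convex_dual :: "('a::real_vector \<Rightarrow> real) \<Rightarrow> bool" where
  "strictly_convex_dual N \<longleftrightarrow>
     (\<forall>f\<in>dual_space N. \<forall>g\<in>dual_space N.
        dual_norm N f = 1 \<and> dual_norm N g = 1 \<and> f \<noteq> g \<longrightarrow> dual_norm N (\<lambda>x. (f x + g x) / 2) < 1)"

definition uniformly_convex :: "('a::real_vector \<Rightarrow> real) \<Rightarrow> bool" where
  "uniformly_convex N \<longleftrightarrow>
     (\<forall>\<epsilon>>0. \<exists>\<delta>>0. \<forall>x y. N x = 1 \<and> N y = 1 \<and> N (x - y) \<ge> \<epsilon> \<longrightarrow> N ((1/2) *\<^sub>R (x + y)) \<le> 1 - \<delta>)"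

text \<open>The modulus of smoothness \<open>\<rho>(t) = sup {(\<parallel>x + t y\<parallel> + \<parallel>x - t y\<parallel>) / 2 - 1 | \<parallel>x\<parallel> = \<parallel>y\<parallel> = 1}\<close>
  satisfies \<open>\<rho>(t) / t \<longlonglongrightarrow> 0\<close> as \<open>t\<close> tends to \<open>0\<close> from the right.\<close>

definition uniformly_smooth :: "('a::real_vector \<Rightarrow> real) \<Rightarrow> bool" where
  "uniformly_smooth N \<longleftrightarrow>
     (\<forall>\<epsilon>>0. \<exists>\<delta>>0. \<forall>t x y. 0 < t \<and> t \<le> \<delta> \<and> N x = 1 \<and> N y = 1 \<longrightarrow>
        (N (x + t *\<^sub>R y) + N (x - t *\<^sub>R y)) / 2 - 1 \<le> \<epsilon> * t)"

text \<open>The duality pairing of \<open>f\<close> and \<open>x\<close> is \<open>f x\<close>. The description operator is meaningful when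
  the dual is strictly convex, since then the functional is unique; its existence is
  the Hahn-Banach theorem.\<close>

definition duality_map :: "('a::real_vector \<Rightarrow> real) \<Rightarrow> 'a \<Rightarrow> 'a \<Rightarrow> real" where
  "duality_map N x = (THE f. f \<in> dual_space N \<and> f x = (dual_norm N f)\<^sup>2 \<and> (dual_norm N f)\<^sup>2 = (N x)\<^sup>2)"

definition cone_with_vertex :: "'a::real_vector \<Rightarrow> 'a set \<Rightarrow> bool" where
  "cone_with_vertex v K \<longleftrightarrow> v \<in> K \<and> (\<forall>x\<in>K. \<forall>t\<ge>0. v + t *\<^sub>R (x - v) \<in> K)"

definition dual_cone :: "('a::real_vector \<Rightarrow> real) \<Rightarrow> 'a \<Rightarrow> 'a set \<Rightarrow> 'a set" where
  "dual_cone N v L = {x. \<forall>z\<in>L. duality_map N (x - v) (v - z) \<ge> 0}"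

text \<open>Meaningful for uniformly convex \<open>N\<close> and nonempty, closed and convex \<open>C\<close>, where the
  nearest point exists and is unique.\<close>

definition metric_projection :: "('a::real_vector \<Rightarrow> real) \<Rightarrow> 'a set \<Rightarrow> 'a \<Rightarrow> 'a" where
  "metric_projection N C x = (THE y. y \<in> C \<and> (\<forall>z\<in>C. N (x - y) \<le> N (x - z)))"

lemma dist_of_norm_eq: "dist_of (norm :: 'a::real_normed_vector \<Rightarrow> real) = dist"
  by (simp add: dist_of_def dist_norm fun_eq_iff)

lemma banach_norm_norm_eq: "banach_norm (norm :: 'a::banach \<Rightarrow> real)"
  by (simp add: banach_norm_def norm_fun_def dist_of_norm_eq norm_triangle_ineq complete_UNIV)

lemma norm_closed_norm_eq: "norm_closed (norm :: 'a::real_normed_vector \<Rightarrow> real) S \<longleftrightarrow> closed S"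
  by (simp add: norm_closed_def dist_of_norm_eq)

lemma dual_space_norm_eq:
  "dual_space (norm :: 'a::real_normed_vector \<Rightarrow> real) = {f. bounded_linear f}"
  by (auto simp: dual_space_def bounded_linear_def bounded_linear_axioms_def mult.commute)

lemma dual_norm_norm_eq:
  fixes f :: "'a::real_normed_vector \<Rightarrow> real"
  assumes f: "bounded_linear f"
  shows "dual_norm norm f = onorm f"
proof (rule antisym)
  have bound: "\<bar>f x\<bar> \<le> onorm f" if "norm x \<le> 1" for x
  proof -
    have "\<bar>f x\<bar> \<le> onorm f * norm x"
      using onorm[OF f, of x] by simp
    also have "\<dots> \<le> onorm f"
      using that onorm_pos_le[OF f] by (simp add: mult_left_le)
    finally show ?thesis .
  qed
  then have bdd: "bdd_above ((\<lambda>x. \<bar>f x\<bar>) ` {x. norm x \<le> 1})"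
    by (auto simp: bdd_above_def)
  have ne: "{x::'a. norm x \<le> 1} \<noteq> {}"
    by (metis (mono_tags) empty_iff mem_Collect_eq norm_zero zero_le_one)
  show "dual_norm norm f \<le> onorm f"
    unfolding dual_norm_def using bound ne by (intro cSUP_least) auto
  have le: "\<bar>f x\<bar> \<le> dual_norm norm f" if "norm x \<le> 1" for x
    unfolding dual_norm_def using that bdd by (intro cSUP_upper) auto
  interpret bounded_linear f by (rule f)
  show "onorm f \<le> dual_norm norm f"
  proof (rule onorm_bound)
    show "0 \<le> dual_norm norm f"
      using le[of 0] by (simp add: zero)
    show "norm (f x) \<le> dual_norm norm f * norm x" for x
    proof (cases "x = 0")
      case False
      then have "\<bar>f (x /\<^sub>R norm x)\<bar> \<le> dual_norm norm f"
        by (intro le) simp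
      with False show ?thesis
        by (simp add: scaleR abs_mult field_simps)
    qed (simp add: zero)
  qed
qed

end

theory Submission
  imports Defs
begin

text \<open>
  The Hahn-Banach theorem and the strict convexity of the dual give
  \<open>\<langle>J x, w\<rangle> \<ge> 0\<close> if and only if \<open>\<parallel>x\<parallel> \<le> \<parallel>x + t w\<parallel>\<close> for all \<open>t \<ge> 0\<close>. As \<open>K\<close> is a cone,
  the dual cone therefore consists of the points for which \<open>v\<close> is a nearest point of \<open>K\<close>.
  This set is visibly a closed cone, and the fibre of the projection over \<open>v\<close> once nearest points
  exist and are unique. For the counterexamples take the \<open>\<ell>\<^sup>4\<close> norm on \<open>\<real>\<^sup>3\<close>, where \<open>\<langle>J x, z\<rangle>\<close> is
  a positive multiple of \<open>x\<^sub>1\<^sup>3 z\<^sub>1 + x\<^sub>2\<^sup>3 z\<^sub>2 + x\<^sub>3\<^sup>3 z\<^sub>3\<close>: the dual cone of the ray through \<open>(1, 1, 1)\<close> is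
  the nonconvex set \<open>x\<^sub>1\<^sup>3 + x\<^sub>2\<^sup>3 + x\<^sub>3\<^sup>3 \<le> 0\<close>, and it contains \<open>(2, 2, -3)\<close> although
  \<open>2 + 2 - 3 > 0\<close>.
\<close>

section \<open>The Hahn-Banach theorem for sublinear functionals\<close>

definition sublinear :: "('a::real_vector \<Rightarrow> real) \<Rightarrow> bool" where
  "sublinear p \<longleftrightarrow>
     (\<forall>x y. p (x + y) \<le> p x + p y) \<and> (\<forall>c x. 0 \<le> c \<longrightarrow> p (c *\<^sub>R x) = c * p x)"

lemma sublinear_add: "sublinear p \<Longrightarrow> p (x + y) \<le> p x + p y"
  by (simp add: sublinear_def)

lemma sublinear_scaleR: "sublinear p \<Longrightarrow> 0 \<le> c \<Longrightarrow> p (c *\<^sub>R x) = c * p x"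
  by (simp add: sublinear_def)

lemma sublinear_zero: "sublinear p \<Longrightarrow> p 0 = 0"
  using sublinear_scaleR[of p 0 0] by simp

lemma sublinear_minus_le: "sublinear p \<Longrightarrow> - p (- x) \<le> p x"
  using sublinear_add[of p x "- x"] sublinear_zero[of p] by simp

text \<open>Serves both the decrease along one direction and the chains in Zorn's lemma. The
  required bounds need only hold for some member of \<open>F\<close> chosen after the points,
  because the infimum lies below every member.\<close>

lemma sublinear_INF:
  fixes F :: "('a::real_vector \<Rightarrow> real) set"
  assumes ne: "F \<noteq> {}"
    and bdd: "\<And>x. bdd_below ((\<lambda>q. q x) ` F)"
    and zero: "(INF q\<in>F. q 0) = 0"
    and add: "\<And>q1 q2 x y. q1 \<in> F \<Longrightarrow> q2 \<in> F \<Longrightarrow> \<exists>q\<in>F. q (x + y) \<le> q1 x + q2 y"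
    and scale: "\<And>q c x. q \<in> F \<Longrightarrow> 0 < c \<Longrightarrow> \<exists>q'\<in>F. q' (c *\<^sub>R x) \<le> c * q x"
  shows "sublinear (\<lambda>x. INF q\<in>F. q x)"
proof -
  define u where "u x = (INF q\<in>F. q x)" for x
  have u_le: "u x \<le> q x" if "q \<in> F" for q x
    unfolding u_def using that by (intro cINF_lower bdd)
  have le_u: "a \<le> u x" if "\<And>q. q \<in> F \<Longrightarrow> a \<le> q x" for a x
    unfolding u_def using that ne by (intro cINF_greatest)
  have sub: "u (x + y) \<le> u x + u y" for x y
  proof -
    have "u (x + y) - q2 y \<le> u x" if "q2 \<in> F" for q2
    proof (rule le_u)
      fix q1 assume "q1 \<in> F"
      then obtain q where "q \<in> F" "q (x + y) \<le> q1 x + q2 y"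
        using add \<open>q2 \<in> F\<close> by blast
      with u_le[of q "x + y"] show "u (x + y) - q2 y \<le> q1 x"
        by simp
    qed
    then have "u (x + y) - u x \<le> u y"
      by (intro le_u) (simp add: algebra_simps)
    then show ?thesis
      by simp
  qed
  have sc_le: "u (c *\<^sub>R x) \<le> c * u x" if "0 < c" for c x
  proof -
    have "u (c *\<^sub>R x) / c \<le> u x"
    proof (rule le_u)
      fix q assume "q \<in> F"
      then obtain q' where "q' \<in> F" "q' (c *\<^sub>R x) \<le> c * q x"
        using scale \<open>0 < c\<close> by blast
      with u_le[of q' "c *\<^sub>R x"] that show "u (c *\<^sub>R x) / c \<le> q x"
        by (simp add: divide_le_eq mult.commute)
    qed
    then show ?thesis
      using that by (simp add: divide_le_eq mult.commute)
  qed
  have "u (c *\<^sub>R x) = c * u x" if "0 \<le> c" for c x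
  proof (cases "c = 0")
    case True
    then show ?thesis
      using zero by (simp add: u_def)
  next
    case False
    with that have "0 < c" by simp
    \<comment> \<open>The bound with factor \<open>1 / c\<close> at the scaled point is the reverse
      inequality.\<close>
    with sc_le[of "1 / c" "c *\<^sub>R x"] have "c * u x \<le> u (c *\<^sub>R x)"
      by (simp add: field_simps)
    with sc_le[OF \<open>0 < c\<close>, of x] show ?thesis
      by simp
  qed
  with sub have "sublinear u"
    by (simp add: sublinear_def)
  then show ?thesis
    by (simp add: u_def[abs_def])
qed

text \<open>Take for \<open>r x\<close> the infimum of \<open>p (x + t y) - t a\<close> over
  \<open>t >= 0\<close>. Every linear \<open>f\<close> below \<open>r\<close> then has
  \<open>f y \<ge> a\<close>. The last property, that of a greatest lower bound, keeps
  \<open>r\<close> large where \<open>p\<close> does not drop along \<open>y\<close>.\<close>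

lemma sublinear_decrease:
  assumes p: "sublinear p" and a: "a \<le> p y"
  obtains r where "sublinear r" "\<And>x. r x \<le> p x" "r (- y) \<le> - a"
    "\<And>x b. (\<And>t. 0 \<le> t \<Longrightarrow> b \<le> p (x + t *\<^sub>R y) - t * a) \<Longrightarrow> b \<le> r x"
proof -
  define F where "F = (\<lambda>t x. p (x + t *\<^sub>R y) - t * a) ` {0..}"
  define r where "r x = (INF q\<in>F. q x)" for x
  \<comment> \<open>A bound independent of \<open>t\<close> makes the infimum finite; this is where
    \<open>a \<le> p y\<close> enters.\<close>
  have lower: "- p (- x) \<le> p (x + t *\<^sub>R y) - t * a" if "0 \<le> t" for t x
  proof -
    have "t * a \<le> p (t *\<^sub>R y)"
      using that a by (simp add: sublinear_scaleR[OF p] mult_left_mono)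
    also have "\<dots> \<le> p (- x) + p (x + t *\<^sub>R y)"
      using sublinear_add[OF p, of "- x" "x + t *\<^sub>R y"] by simp
    finally show ?thesis by simp
  qed
  have bdd: "bdd_below ((\<lambda>q. q x) ` F)" for x
    using lower by (intro bdd_belowI[of _ "- p (- x)"]) (auto simp: F_def)
  have r_le: "r x \<le> p (x + t *\<^sub>R y) - t * a" if "0 \<le> t" for t x
    unfolding r_def using that
    by (intro cINF_lower2[OF bdd, of "\<lambda>x. p (x + t *\<^sub>R y) - t * a"]) (auto simp: F_def)
  have le_r: "b \<le> r x" if "\<And>t. 0 \<le> t \<Longrightarrow> b \<le> p (x + t *\<^sub>R y) - t * a" for x b
    unfolding r_def using that by (intro cINF_greatest) (auto simp: F_def)
  have "sublinear r"
    unfolding r_def[abs_def]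
  proof (rule sublinear_INF)
    show "F \<noteq> {}"
      by (simp add: F_def)
    have "r 0 \<le> 0"
      using r_le[of 0 0] by (simp add: sublinear_zero[OF p])
    moreover have "0 \<le> r 0"
      by (rule le_r) (use lower[of _ 0] in \<open>simp add: sublinear_zero[OF p]\<close>)
    ultimately show "(INF q\<in>F. q 0) = 0"
      by (simp add: r_def)
  next
    fix q1 q2 x z
    assume "q1 \<in> F" "q2 \<in> F"
    then obtain s t where st: "0 \<le> s" "0 \<le> t"
      "q1 = (\<lambda>x. p (x + s *\<^sub>R y) - s * a)" "q2 = (\<lambda>x. p (x + t *\<^sub>R y) - t * a)"
      by (auto simp: F_def)
    have "p (x + z + (s + t) *\<^sub>R y) \<le> p (x + s *\<^sub>R y) + p (z + t *\<^sub>R y)"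
      using sublinear_add[OF p, of "x + s *\<^sub>R y" "z + t *\<^sub>R y"] by (simp add: algebra_simps)
    then have "p (x + z + (s + t) *\<^sub>R y) - (s + t) * a \<le> q1 x + q2 z"
      by (simp add: st algebra_simps)
    then show "\<exists>q\<in>F. q (x + z) \<le> q1 x + q2 z"
      using st(1,2) unfolding F_def by (intro bexI[OF _ imageI[of "s + t"]]) auto
  next
    fix q c x
    assume "q \<in> F" and c: "0 < (c::real)"
    then obtain t where t: "0 \<le> t" "q = (\<lambda>x. p (x + t *\<^sub>R y) - t * a)"
      by (auto simp: F_def)
    have "p (c *\<^sub>R x + (c * t) *\<^sub>R y) = c * p (x + t *\<^sub>R y)"
      using sublinear_scaleR[OF p, of c "x + t *\<^sub>R y"] c by (simp add: scaleR_add_right)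
    then have "p (c *\<^sub>R x + (c * t) *\<^sub>R y) - (c * t) * a \<le> c * q x"
      by (simp add: t algebra_simps)
    then show "\<exists>q'\<in>F. q' (c *\<^sub>R x) \<le> c * q x"
      using c t(1) unfolding F_def by (intro bexI[OF _ imageI[of "c * t"]]) auto
  qed (rule bdd)
  moreover have "r x \<le> p x" for x
    using r_le[of 0 x] by simp
  moreover have "r (- y) \<le> - a"
    using r_le[of 1 "- y"] by (simp add: sublinear_zero[OF p])
  ultimately show ?thesis
    using le_r that by blast
qed

text \<open>Decreasing \<open>q\<close> along \<open>y\<close> with \<open>a = q y\<close> cannot
  change a minimal \<open>q\<close>, so \<open>q (- y) \<le> - q y\<close>. Oddness turns
  subadditivity into additivity.\<close>

lemma minimal_sublinear_imp_linear:
  assumes q: "sublinear q"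
    and min: "\<And>r. sublinear r \<Longrightarrow> (\<And>x. r x \<le> q x) \<Longrightarrow> r = q"
  shows "linear q"
proof -
  have odd: "q (- y) = - q y" for y
  proof -
    obtain r where "sublinear r" "\<And>x. r x \<le> q x" "r (- y) \<le> - q y"
      using sublinear_decrease[OF q order_refl, of y] by metis
    with min have "q (- y) \<le> - q y"
      by metis
    with sublinear_minus_le[OF q, of y] show ?thesis
      by simp
  qed
  have "q (x + y) = q x + q y" for x y
    using sublinear_add[OF q, of x y] sublinear_add[OF q, of "x + y" "- y"]
    by (simp add: odd)
  moreover have "q (c *\<^sub>R x) = c * q x" for c x
  proof (cases "0 \<le> c")
    case False
    then show ?thesis
      using sublinear_scaleR[OF q, of "- c" x] by (simp add: odd)
  qed (rule sublinear_scaleR[OF q])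
  ultimately show ?thesis
    by (intro linearI) auto
qed

text \<open>Zorn's lemma for the reversed pointwise order gives a minimal sublinear function below
  \<open>p\<close>, and minimal ones are linear.\<close>

lemma linear_minorant_exists:
  fixes p :: "'a::real_vector \<Rightarrow> real"
  assumes p: "sublinear p"
  obtains f where "linear f" "\<And>x. f x \<le> p x"
proof -
  define A where "A = {q. sublinear q \<and> q \<le> p}"
  have "\<exists>m\<in>A. \<forall>q\<in>A. q \<le> m \<longrightarrow> q = m"
  proof (rule predicate_Zorn[where P = "\<lambda>q r. r \<le> q"])
    show "partial_order_on A (relation_of (\<lambda>q r. r \<le> q) A)"
      by (rule partial_order_on_relation_ofI) auto
  next
    fix C assume "C \<in> Chains (relation_of (\<lambda>q r. r \<le> q) A)"
    then have CA: "C \<subseteq> A" and chain: "\<And>q r. q \<in> C \<Longrightarrow> r \<in> C \<Longrightarrow> q \<le> r \<or> r \<le> q"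
      by (auto simp: Chains_def relation_of_def)
    show "\<exists>u\<in>A. \<forall>q\<in>C. u \<le> q"
    proof (cases "C = {}")
      case True
      then show ?thesis
        using p by (auto simp: A_def)
    next
      case False
      have sub: "sublinear q" if "q \<in> C" for q
        using CA that by (auto simp: A_def)
      have le_p: "q x \<le> p x" if "q \<in> C" for q x
        using CA that by (auto simp: A_def le_fun_def)
      define u where "u x = (INF q\<in>C. q x)" for x
      \<comment> \<open>All members of the chain share the bound \<open>- p (- x)\<close>, because
        \<open>- p (- x) \<le> - q (- x) \<le> q x\<close>.\<close>
      have bdd: "bdd_below ((\<lambda>q. q x) ` C)" for x
      proof (rule bdd_belowI2[of _ "- p (- x)"])
        fix q assume "q \<in> C"
        then show "- p (- x) \<le> q x"
          using sublinear_minus_le[OF sub, of q x] le_p[of q "- x"] by simp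
      qed
      have u_le: "u x \<le> q x" if "q \<in> C" for q x
        unfolding u_def using that by (intro cINF_lower bdd)
      have "sublinear u"
        unfolding u_def[abs_def]
      proof (rule sublinear_INF[OF False bdd])
        show "(INF q\<in>C. q 0) = 0"
          using False by (simp add: sublinear_zero sub)
      next
        fix q1 q2 x y
        assume "q1 \<in> C" "q2 \<in> C"
        with chain obtain q where "q \<in> C" "q \<le> q1" "q \<le> q2"
          by blast
        then show "\<exists>q\<in>C. q (x + y) \<le> q1 x + q2 y"
          using sublinear_add[OF sub, of q x y] by (meson add_mono le_funD order_trans)
      next
        fix q c x
        assume "q \<in> C" "0 < (c::real)"
        then show "\<exists>q'\<in>C. q' (c *\<^sub>R x) \<le> c * q x"
          using sublinear_scaleR[OF sub] by (intro bexI[of _ q]) auto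
      qed
      moreover have "u \<le> p"
        using False u_le le_p unfolding le_fun_def by (meson all_not_in_conv order_trans)
      ultimately show ?thesis
        using u_le by (intro bexI[of _ u]) (auto simp: A_def le_fun_def)
    qed
  qed
  then obtain m where m: "sublinear m" "m \<le> p"
    and min: "\<And>q. sublinear q \<Longrightarrow> q \<le> p \<Longrightarrow> q \<le> m \<Longrightarrow> q = m"
    by (auto simp: A_def)
  have "linear m"
  proof (rule minimal_sublinear_imp_linear[OF m(1)])
    fix r assume "sublinear r" "\<And>x. r x \<le> m x"
    with m(2) show "r = m"
      by (intro min) (auto simp: le_fun_def intro: order_trans)
  qed
  with m that show ?thesis
    by (auto simp: le_fun_def)
qed

text \<open>Decrease \<open>p\<close> along \<open>x0\<close> with \<open>a = p x0\<close>: any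
  linear minorant of the result has \<open>f x0 \<ge> p x0\<close>.\<close>

theorem hahn_banach_support:
  fixes p :: "'a::real_vector \<Rightarrow> real"
  assumes p: "sublinear p"
  obtains f where "linear f" "\<And>x. f x \<le> p x" "f x0 = p x0"
proof -
  obtain r where r: "sublinear r" "\<And>x. r x \<le> p x" "r (- x0) \<le> - p x0"
    using sublinear_decrease[OF p order_refl, of x0] by metis
  obtain f where f: "linear f" "\<And>x. f x \<le> r x"
    using linear_minorant_exists[OF r(1)] by metis
  have "p x0 \<le> f x0"
    using f(2)[of "- x0"] r(3) by (simp add: linear_neg[OF f(1)])
  moreover have "f x \<le> p x" for x
    using f(2) r(2) order_trans by blast
  ultimately show ?thesis
    using that f(1) by (metis antisym)
qed

section \<open>The normalized duality mapping\<close>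

context
  fixes N :: "'a::real_vector \<Rightarrow> real"
  assumes N: "norm_fun N"
begin

lemma norm_fun_eq_0_iff: "N x = 0 \<longleftrightarrow> x = 0"
  using N by (simp add: norm_fun_def)

lemma norm_fun_triangle: "N (x + y) \<le> N x + N y"
  using N by (simp add: norm_fun_def)

lemma norm_fun_scaleR: "N (c *\<^sub>R x) = \<bar>c\<bar> * N x"
  using N by (simp add: norm_fun_def)

lemma norm_fun_minus: "N (- x) = N x"
  using norm_fun_scaleR[of "-1" x] by simp

lemma norm_fun_minus_commute: "N (x - y) = N (y - x)"
  using norm_fun_minus[of "x - y"] by simp

lemma norm_fun_nonneg: "0 \<le> N x"
  using norm_fun_triangle[of x "- x"] norm_fun_eq_0_iff[of 0] by (simp add: norm_fun_minus)

lemma norm_fun_triangle_sub: "N (x - z) \<le> N (x - y) + N (y - z)"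
  using norm_fun_triangle[of "x - y" "y - z"] by simp

lemma sublinear_norm_fun: "sublinear N"
  by (simp add: sublinear_def norm_fun_triangle norm_fun_scaleR)

lemma Metric_space_dist_of: "Metric_space UNIV (dist_of N)"
  by unfold_locales
    (auto simp: dist_of_def norm_fun_nonneg norm_fun_eq_0_iff norm_fun_triangle_sub
      intro: norm_fun_minus_commute)

section \<open>Bounded functionals and the dual norm\<close>

lemma abs_le_of_linear:
  assumes "linear f" "\<And>x. f x \<le> C * N x"
  shows "\<bar>f x\<bar> \<le> C * N x"
  using assms(2)[of x] assms(2)[of "- x"] by (simp add: linear_neg[OF assms(1)] norm_fun_minus)

lemma dual_spaceI:
  assumes "linear f" "\<And>x. f x \<le> C * N x"
  shows "f \<in> dual_space N"
  using assms abs_le_of_linear[OF assms] by (auto simp: dual_space_def)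

lemma dual_norm_least:
  assumes "linear f" "\<And>x. f x \<le> C * N x" "0 \<le> C"
  shows "dual_norm N f \<le> C"
  unfolding dual_norm_def
proof (rule cSUP_least)
  show "{x. N x \<le> 1} \<noteq> {}"
    using norm_fun_eq_0_iff[of 0] by (metis (mono_tags) empty_iff mem_Collect_eq zero_le_one)
  fix x assume "x \<in> {x. N x \<le> 1}"
  then have "C * N x \<le> C * 1"
    using assms(3) by (intro mult_left_mono) auto
  then show "\<bar>f x\<bar> \<le> C"
    using abs_le_of_linear[OF assms(1,2), of x] by simp
qed

context
  fixes f :: "'a \<Rightarrow> real"
  assumes f: "f \<in> dual_space N"
begin

lemma dual_norm_upper:
  assumes "N x \<le> 1"
  shows "\<bar>f x\<bar> \<le> dual_norm N f"
proof -
  obtain C where C: "\<And>x. \<bar>f x\<bar> \<le> C * N x"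
    using f by (auto simp: dual_space_def)
  have "\<bar>f y\<bar> \<le> \<bar>C\<bar>" if "N y \<le> 1" for y
  proof -
    have "C * N y \<le> \<bar>C\<bar> * 1"
      using that by (intro mult_mono) (auto simp: norm_fun_nonneg)
    with C[of y] show ?thesis
      by simp
  qed
  then have "bdd_above ((\<lambda>x. \<bar>f x\<bar>) ` {x. N x \<le> 1})"
    by (auto simp: bdd_above_def)
  then show ?thesis
    unfolding dual_norm_def using assms by (intro cSUP_upper) auto
qed

lemma dual_norm_nonneg: "0 \<le> dual_norm N f"
  using dual_norm_upper[of 0] norm_fun_eq_0_iff[of 0] by simp

lemma dual_norm_bound: "\<bar>f x\<bar> \<le> dual_norm N f * N x"
proof (cases "x = 0")
  case True
  then show ?thesis
    using f norm_fun_eq_0_iff[of 0] by (simp add: dual_space_def linear_0)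
next
  case False
  then have pos: "0 < N x"
    using norm_fun_nonneg[of x] norm_fun_eq_0_iff[of x] by simp
  then have "\<bar>f (x /\<^sub>R N x)\<bar> \<le> dual_norm N f"
    by (intro dual_norm_upper) (simp add: norm_fun_scaleR)
  with pos f show ?thesis
    by (simp add: dual_space_def linear_scale abs_mult field_simps)
qed

end

lemma dual_norm_scale:
  assumes f: "f \<in> dual_space N" and c: "0 < c"
  shows "(\<lambda>x. c * f x) \<in> dual_space N" "dual_norm N (\<lambda>x. c * f x) = c * dual_norm N f"
proof -
  have lin: "linear f"
    using f by (simp add: dual_space_def)
  then have lin': "linear (\<lambda>x. c * f x)"
    using linear_compose_scale_right[of f c] by simp
  have le: "c * f x \<le> (c * dual_norm N f) * N x" for x
    using dual_norm_bound[OF f, of x] c by (simp add: mult.assoc)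
  show cf: "(\<lambda>x. c * f x) \<in> dual_space N"
    using lin' le by (rule dual_spaceI)
  have "dual_norm N (\<lambda>x. c * f x) \<le> c * dual_norm N f"
    using lin' le c dual_norm_nonneg[OF f] by (intro dual_norm_least) auto
  moreover have "dual_norm N f \<le> dual_norm N (\<lambda>x. c * f x) / c"
  proof (rule dual_norm_least[OF lin])
    show "f x \<le> dual_norm N (\<lambda>x. c * f x) / c * N x" for x
      using dual_norm_bound[OF cf, of x] c by (simp add: field_simps abs_le_iff)
    show "0 \<le> dual_norm N (\<lambda>x. c * f x) / c"
      using c dual_norm_nonneg[OF cf] by simp
  qed
  ultimately show "dual_norm N (\<lambda>x. c * f x) = c * dual_norm N f"
    using c by (simp add: field_simps)
qed

context
  assumes scd: "strictly_convex_dual N"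
begin

section \<open>Uniqueness and explicit form of the duality mapping\<close>

text \<open>Makes the description in \<open>duality_map\<close> well defined. Two different
  candidates, scaled to dual norm 1, would have a midpoint of norm below 1, yet the midpoint still
  takes the value \<open>N x\<close> at \<open>x\<close>.\<close>

lemma norming_functional_unique:
  assumes f: "f \<in> dual_space N" "dual_norm N f = N x" "f x = (N x)\<^sup>2"
    and g: "g \<in> dual_space N" "dual_norm N g = N x" "g x = (N x)\<^sup>2"
  shows "f = g"
proof (cases "x = 0")
  case True
  then have "f y = 0" "g y = 0" for y
    using dual_norm_bound[OF f(1), of y] dual_norm_bound[OF g(1), of y] f(2) g(2)
      norm_fun_eq_0_iff[of 0] by simp_all
  then show ?thesis
    by auto
next
  case False
  define c where "c = 1 / N x"
  have pos: "0 < N x"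
    using False norm_fun_nonneg[of x] norm_fun_eq_0_iff[of x] by simp
  then have c: "0 < c"
    by (simp add: c_def)
  define f' g' where "f' y = c * f y" and "g' y = c * g y" for y
  have f': "f' \<in> dual_space N" "dual_norm N f' = 1" "f' x = N x"
    using dual_norm_scale[OF f(1) c] f pos
    by (simp_all add: f'_def[abs_def] c_def power2_eq_square)
  have g': "g' \<in> dual_space N" "dual_norm N g' = 1" "g' x = N x"
    using dual_norm_scale[OF g(1) c] g pos
    by (simp_all add: g'_def[abs_def] c_def power2_eq_square)
  let ?h = "\<lambda>y. (f' y + g' y) / 2"
  have "linear f'" "linear g'"
    using f'(1) g'(1) by (simp_all add: dual_space_def)
  then have "linear ?h"
    by (intro linearI) (simp_all add: linear_add linear_scale field_simps)
  moreover have "?h y \<le> 1 * N y" for y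
    using dual_norm_bound[OF f'(1), of y] dual_norm_bound[OF g'(1), of y] f' g' by simp
  ultimately have "?h \<in> dual_space N"
    by (rule dual_spaceI)
  from dual_norm_bound[OF this, of x] have "1 \<le> dual_norm N ?h"
    using pos f' g' by simp
  then have "f' = g'"
    using scd f' g' unfolding strictly_convex_dual_def by (metis not_less)
  then show ?thesis
    using c by (auto simp: f'_def g'_def fun_eq_iff)
qed

lemma duality_map_eqI:
  assumes "f \<in> dual_space N" "dual_norm N f = N x" "f x = (N x)\<^sup>2"
  shows "duality_map N x = f"
  unfolding duality_map_def
proof (rule the_equality)
  show "f \<in> dual_space N \<and> f x = (dual_norm N f)\<^sup>2 \<and> (dual_norm N f)\<^sup>2 = (N x)\<^sup>2"
    using assms by simp
  fix g assume g: "g \<in> dual_space N \<and> g x = (dual_norm N g)\<^sup>2 \<and> (dual_norm N g)\<^sup>2 = (N x)\<^sup>2"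
  then have "dual_norm N g = N x"
    using dual_norm_nonneg[of g] norm_fun_nonneg[of x] by (metis power2_eq_iff_nonneg)
  with g assms show "g = f"
    by (intro norming_functional_unique[where x = x]) auto
qed

text \<open>Translates the supporting functional from the Hahn-Banach theorem into the value of
  \<open>duality_map\<close>. The factor \<open>N x\<close> also covers \<open>x = 0\<close>, where
  the product vanishes.\<close>

lemma duality_map_eq_scale:
  assumes f: "linear f" "\<And>y. f y \<le> N y" "f x = N x"
  shows "duality_map N x = (\<lambda>y. N x * f y)"
    and "(\<lambda>y. N x * f y) \<in> dual_space N" and "dual_norm N (\<lambda>y. N x * f y) = N x"
proof -
  have lin: "linear (\<lambda>y. N x * f y)"
    using linear_compose_scale_right[OF f(1), of "N x"] by simp
  have le: "N x * f y \<le> N x * N y" for y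
    using f(2) by (simp add: mult_left_mono norm_fun_nonneg)
  show mem: "(\<lambda>y. N x * f y) \<in> dual_space N"
    using lin le by (rule dual_spaceI)
  have "dual_norm N (\<lambda>y. N x * f y) \<le> N x"
    using lin le norm_fun_nonneg by (rule dual_norm_least)
  moreover have "N x \<le> dual_norm N (\<lambda>y. N x * f y)"
  proof (cases "N x = 0")
    case True
    with dual_norm_nonneg[OF mem] show ?thesis
      by simp
  next
    case False
    then have "0 < N x"
      using norm_fun_nonneg[of x] by simp
    with dual_norm_bound[OF mem, of x] f(3) show ?thesis
      by (simp add: abs_mult)
  qed
  ultimately show dn: "dual_norm N (\<lambda>y. N x * f y) = N x"
    by simp
  show "duality_map N x = (\<lambda>y. N x * f y)"
    using f(3) by (intro duality_map_eqI mem dn) (simp add: power2_eq_square)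
qed

text \<open>Birkhoff-James orthogonality, in its one-sided form, expresses the sign of the duality
  mapping through the norm alone. For the direction from right to left, the
  Hahn-Banach theorem is applied to the sublinear functional
  \<open>y \<mapsto> inf {N (y + t w) | t \<ge> 0}\<close>, which agrees with \<open>N\<close> at \<open>x\<close> and is nonpositive at \<open>- w\<close>.\<close>

lemma duality_map_nonneg_iff:
  "0 \<le> duality_map N x w \<longleftrightarrow> (\<forall>t\<ge>0. N x \<le> N (x + t *\<^sub>R w))"
proof
  assume nonneg: "0 \<le> duality_map N x w"
  obtain f where f: "linear f" "\<And>y. f y \<le> N y" "f x = N x"
    using hahn_banach_support[OF sublinear_norm_fun, of x] by metis
  note J = duality_map_eq_scale(1)[OF f]
  \<comment> \<open>At \<open>x = 0\<close> the duality mapping vanishes and says nothing about the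
    sign of \<open>f w\<close>, hence the case split.\<close>
  show "\<forall>t\<ge>0. N x \<le> N (x + t *\<^sub>R w)"
  proof (cases "x = 0")
    case True
    then show ?thesis
      using norm_fun_eq_0_iff[of 0] by (simp add: norm_fun_nonneg)
  next
    case False
    then have "0 < N x"
      using norm_fun_nonneg[of x] norm_fun_eq_0_iff[of x] by simp
    with nonneg have fw: "0 \<le> f w"
      by (simp add: J zero_le_mult_iff)
    show ?thesis
    proof (intro allI impI)
      fix t :: real assume "0 \<le> t"
      with fw have "N x \<le> f (x + t *\<^sub>R w)"
        by (simp add: linear_add[OF f(1)] linear_scale[OF f(1)] f(3))
      also have "\<dots> \<le> N (x + t *\<^sub>R w)"
        by (rule f(2))
      finally show "N x \<le> N (x + t *\<^sub>R w)" .
    qed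
  qed
next
  assume *: "\<forall>t\<ge>0. N x \<le> N (x + t *\<^sub>R w)"
  obtain r where r: "sublinear r" "\<And>y. r y \<le> N y" "r (- w) \<le> - 0"
    "\<And>y b. (\<And>t. 0 \<le> t \<Longrightarrow> b \<le> N (y + t *\<^sub>R w) - t * 0) \<Longrightarrow> b \<le> r y"
    using sublinear_decrease[OF sublinear_norm_fun norm_fun_nonneg, of w] by metis
  obtain f where f: "linear f" "\<And>y. f y \<le> r y" "f x = r x"
    using hahn_banach_support[OF r(1), of x] by metis
  have "N x \<le> r x"
    using * by (intro r(4)) simp
  with r(2)[of x] f(3) have "f x = N x"
    by simp
  moreover have "f y \<le> N y" for y
    using f(2) r(2) order_trans by blast
  ultimately have "duality_map N x = (\<lambda>y. N x * f y)"
    using f(1) by (intro duality_map_eq_scale)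
  moreover have "0 \<le> f w"
    using f(2)[of "- w"] r(3) by (simp add: linear_neg[OF f(1)])
  ultimately show "0 \<le> duality_map N x w"
    by (simp add: norm_fun_nonneg)
qed

section \<open>The dual cone as a set of points nearest to the vertex\<close>

text \<open>Since \<open>x - v + t (v - z) = x - (v + t (z - v))\<close> and \<open>K\<close>
  contains the ray from \<open>v\<close> through \<open>z\<close>, the quantifier over
  \<open>t\<close> is absorbed by the one over \<open>z\<close>; conversely, \<open>t = 1\<close>
  suffices.\<close>

lemma dual_cone_eq_nearest:
  assumes K: "cone_with_vertex v K"
  shows "dual_cone N v K = {x. \<forall>z\<in>K. N (x - v) \<le> N (x - z)}"
proof -
  have "(\<forall>z\<in>K. \<forall>t\<ge>0. N (x - v) \<le> N (x - v + t *\<^sub>R (v - z))) \<longleftrightarrow>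
        (\<forall>z\<in>K. N (x - v) \<le> N (x - z))" (is "?L \<longleftrightarrow> ?R") for x
  proof
    assume L: ?L
    show ?R
    proof
      fix z assume "z \<in> K"
      with L have "N (x - v) \<le> N (x - v + 1 *\<^sub>R (v - z))"
        using zero_le_one by blast
      then show "N (x - v) \<le> N (x - z)"
        by simp
    qed
  next
    assume R: ?R
    show ?L
    proof (intro ballI allI impI)
      fix z and t :: real assume "z \<in> K" "0 \<le> t"
      then have "v + t *\<^sub>R (z - v) \<in> K"
        using K by (simp add: cone_with_vertex_def)
      with R have "N (x - v) \<le> N (x - (v + t *\<^sub>R (z - v)))"
        by blast
      also have "x - (v + t *\<^sub>R (z - v)) = x - v + t *\<^sub>R (v - z)"
        by (simp add: algebra_simps)
      finally show "N (x - v) \<le> N (x - v + t *\<^sub>R (v - z))" .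
    qed
  qed
  then show ?thesis
    by (simp add: dual_cone_def duality_map_nonneg_iff)
qed

lemma cone_with_vertex_dual_cone:
  assumes K: "cone_with_vertex v K"
  shows "cone_with_vertex v (dual_cone N v K)"
  unfolding cone_with_vertex_def dual_cone_eq_nearest[OF K]
proof (intro conjI ballI allI impI)
  show "v \<in> {x. \<forall>z\<in>K. N (x - v) \<le> N (x - z)}"
    using norm_fun_eq_0_iff[of 0] by (simp add: norm_fun_nonneg)
next
  fix x and t :: real
  assume x: "x \<in> {x. \<forall>z\<in>K. N (x - v) \<le> N (x - z)}" and t: "0 \<le> t"
  have "N (t *\<^sub>R (x - v)) \<le> N (v + t *\<^sub>R (x - v) - z)" if z: "z \<in> K" for z
  proof (cases "t = 0")
    case True
    then show ?thesis
      using norm_fun_eq_0_iff[of 0] by (simp add: norm_fun_nonneg)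
  next
    case False
    \<comment> \<open>Shrinking the offset of \<open>z\<close> from \<open>v\<close> by
      \<open>t\<close> lets homogeneity of \<open>N\<close> carry the inequality at \<open>x\<close>
      over to the scaled point.\<close>
    let ?z = "v + (1 / t) *\<^sub>R (z - v)"
    have "?z \<in> K"
      using K z t by (simp add: cone_with_vertex_def)
    then have "t * N (x - v) \<le> t * N (x - ?z)"
      using x t by (simp add: mult_left_mono)
    moreover have "v + t *\<^sub>R (x - v) - z = t *\<^sub>R (x - ?z)"
      using False by (simp add: algebra_simps)
    ultimately show ?thesis
      using t by (simp add: norm_fun_scaleR)
  qed
  then show "v + t *\<^sub>R (x - v) \<in> {x. \<forall>z\<in>K. N (x - v) \<le> N (x - z)}"
    by simp
qed

text \<open>The complement is open: if some \<open>z\<close> in \<open>K\<close> is strictly closer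
  to \<open>x\<close> than \<open>v\<close> is, moving \<open>x\<close> by less than half the gap
  changes each distance by less than that half.\<close>

lemma norm_closed_dual_cone:
  assumes K: "cone_with_vertex v K"
  shows "norm_closed N (dual_cone N v K)"
proof -
  interpret Metric_space UNIV "dist_of N"
    by (rule Metric_space_dist_of)
  show ?thesis
    unfolding norm_closed_def closedin_metric dual_cone_eq_nearest[OF K]
  proof (intro conjI allI impI)
    fix x assume "x \<in> UNIV - {x. \<forall>z\<in>K. N (x - v) \<le> N (x - z)}"
    then obtain z where z: "z \<in> K" "N (x - z) < N (x - v)"
      by (auto simp: not_le)
    let ?r = "(N (x - v) - N (x - z)) / 2"
    have "\<not> N (y - v) \<le> N (y - z)" if "N (x - y) < ?r" for y
      using norm_fun_triangle_sub[of x v y] norm_fun_triangle_sub[of y z x] that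
        norm_fun_minus_commute[of x y] by (simp add: field_simps)
    then show "\<exists>r>0. disjnt {x. \<forall>z\<in>K. N (x - v) \<le> N (x - z)} (mball x r)"
      using z by (intro exI[of _ ?r]) (auto simp: disjnt_def dist_of_def)
  qed simp
qed

end

section \<open>Metric projections in uniformly convex spaces\<close>

text \<open>Extends uniform convexity from the unit sphere to a thin shell around it by normalising
  both vectors.\<close>

lemma uniformly_convex_almost_unit:
  assumes uc: "uniformly_convex N" and "0 < \<epsilon>"
  obtains \<eta> where "0 < \<eta>"
    "\<And>a b. 1 \<le> N a \<Longrightarrow> N a \<le> 1 + \<eta> \<Longrightarrow> 1 \<le> N b \<Longrightarrow> N b \<le> 1 + \<eta> \<Longrightarrow>
       1 \<le> N ((1/2) *\<^sub>R (a + b)) \<Longrightarrow> N (a - b) < \<epsilon>"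
proof -
  obtain \<delta> where \<delta>: "0 < \<delta>"
    "\<And>x y. N x = 1 \<Longrightarrow> N y = 1 \<Longrightarrow> \<epsilon> / 2 \<le> N (x - y) \<Longrightarrow> N ((1/2) *\<^sub>R (x + y)) \<le> 1 - \<delta>"
    using uc \<open>0 < \<epsilon>\<close> unfolding uniformly_convex_def by (metis half_gt_zero)
  \<comment> \<open>The bound \<open>\<delta> / 2\<close> keeps the midpoint of the normalised
    vectors above \<open>1 - \<delta>\<close>; the bound \<open>\<epsilon> / 4\<close> leaves room
    for both normalisation errors next to \<open>\<epsilon> / 2\<close>.\<close>
  define \<eta> where "\<eta> = min (\<delta> / 2) (\<epsilon> / 4)"
  have "N (a - b) < \<epsilon>"
    if a: "1 \<le> N a" "N a \<le> 1 + \<eta>" and b: "1 \<le> N b" "N b \<le> 1 + \<eta>"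
      and mid: "1 \<le> N ((1/2) *\<^sub>R (a + b))" for a b
  proof -
    define a' b' where "a' = a /\<^sub>R N a" and "b' = b /\<^sub>R N b"
    have unit: "N a' = 1" "N b' = 1"
      using a b by (simp_all add: a'_def b'_def norm_fun_scaleR)
    have "a - a' = (N a - 1) *\<^sub>R a'" "b - b' = (N b - 1) *\<^sub>R b'"
      using a b by (simp_all add: a'_def b'_def algebra_simps)
    then have close: "N (a - a') \<le> \<eta>" "N (b - b') \<le> \<eta>"
      using a b unit by (simp_all add: norm_fun_scaleR)
    have "N ((1/2) *\<^sub>R (a + b)) \<le> N ((1/2) *\<^sub>R (a' + b')) + N ((1/2) *\<^sub>R ((a - a') + (b - b')))"
      using norm_fun_triangle[of "(1/2) *\<^sub>R (a' + b')" "(1/2) *\<^sub>R ((a - a') + (b - b'))"]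
      by (simp add: algebra_simps)
    also have "N ((1/2) *\<^sub>R ((a - a') + (b - b'))) \<le> \<eta>"
      using norm_fun_triangle[of "a - a'" "b - b'"] close by (simp add: norm_fun_scaleR)
    finally have "1 - \<delta> < N ((1/2) *\<^sub>R (a' + b'))"
      using mid \<delta>(1) by (simp add: \<eta>_def min_def split: if_splits)
    then have "N (a' - b') < \<epsilon> / 2"
      using \<delta>(2)[OF unit] by fastforce
    moreover have "N (a - b) \<le> N (a - a') + N (a' - b') + N (b - b')"
      using norm_fun_triangle_sub[of a b a'] norm_fun_triangle_sub[of a' b b']
        norm_fun_minus_commute[of b b'] by simp
    moreover have "\<eta> \<le> \<epsilon> / 4"
      by (simp add: \<eta>_def)
    ultimately show ?thesis
      using close by simp
  qed
  moreover have "0 < \<eta>"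
    using \<delta>(1) \<open>0 < \<epsilon>\<close> by (simp add: \<eta>_def)
  ultimately show ?thesis
    using that by blast
qed

text \<open>By convexity the midpoint of \<open>y\<close> and \<open>z\<close> lies in
  \<open>K\<close> and so has distance at least \<open>d\<close> from \<open>x\<close>; scaling by
  \<open>1 / d\<close> gives two vectors in the thin shell. Uniqueness takes for \<open>d\<close> an
  attained distance, existence the infimum.\<close>

lemma almost_nearest_points_close:
  assumes uc: "uniformly_convex N" and K: "convex K" and "0 < \<epsilon>"
    and d: "0 \<le> d" "\<And>z. z \<in> K \<Longrightarrow> d \<le> N (x - z)"
  obtains \<eta> where "0 < \<eta>"
    "\<And>y z. y \<in> K \<Longrightarrow> z \<in> K \<Longrightarrow> N (x - y) \<le> d + \<eta> \<Longrightarrow> N (x - z) \<le> d + \<eta> \<Longrightarrow> N (y - z) < \<epsilon>"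
proof (cases "d = 0")
  case True
  \<comment> \<open>No rescaling is possible for \<open>d = 0\<close>; two distances of at most
    \<open>\<epsilon> / 3\<close> stay below \<open>\<epsilon>\<close> by the triangle
    inequality.\<close>
  show ?thesis
  proof (rule that[of "\<epsilon> / 3"])
    show "N (y - z) < \<epsilon>"
      if "y \<in> K" "z \<in> K" "N (x - y) \<le> d + \<epsilon> / 3" "N (x - z) \<le> d + \<epsilon> / 3" for y z
      using that True \<open>0 < \<epsilon>\<close> norm_fun_triangle_sub[of y z x] norm_fun_minus_commute[of x y]
      by simp
  qed (use \<open>0 < \<epsilon>\<close> in simp)
next
  case False
  with d have pos: "0 < d" by simp
  then obtain \<eta> where \<eta>: "0 < \<eta>"
    "\<And>a b. 1 \<le> N a \<Longrightarrow> N a \<le> 1 + \<eta> \<Longrightarrow> 1 \<le> N b \<Longrightarrow> N b \<le> 1 + \<eta> \<Longrightarrow>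
       1 \<le> N ((1/2) *\<^sub>R (a + b)) \<Longrightarrow> N (a - b) < \<epsilon> / d"
    using uniformly_convex_almost_unit[OF uc, of "\<epsilon> / d"] \<open>0 < \<epsilon>\<close> by auto
  show ?thesis
  proof (rule that[of "d * \<eta>"])
    show "0 < d * \<eta>"
      using pos \<eta>(1) by simp
    fix y z
    assume yz: "y \<in> K" "z \<in> K" "N (x - y) \<le> d + d * \<eta>" "N (x - z) \<le> d + d * \<eta>"
    let ?a = "(1 / d) *\<^sub>R (x - y)" and ?b = "(1 / d) *\<^sub>R (x - z)"
    let ?m = "(1/2) *\<^sub>R y + (1/2) *\<^sub>R z"
    have "?m \<in> K"
      using K yz by (intro convexD) auto
    then have "d \<le> N (x - ?m)"
      by (rule d)
    moreover have "(1/2) *\<^sub>R (?a + ?b) = (1 / d) *\<^sub>R (x - ?m)"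
      by (simp add: algebra_simps flip: scaleR_left_distrib)
    ultimately have "1 \<le> N ((1/2) *\<^sub>R (?a + ?b))"
      using pos by (simp add: norm_fun_scaleR)
    moreover have "1 \<le> N ((1 / d) *\<^sub>R (x - w))" "N ((1 / d) *\<^sub>R (x - w)) \<le> 1 + \<eta>"
      if "w \<in> K" "N (x - w) \<le> d + d * \<eta>" for w
      using that d(2)[of w] pos
      by (simp_all add: norm_fun_scaleR pos_le_divide_eq pos_divide_le_eq distrib_left mult.commute)
    ultimately have "N (?a - ?b) < \<epsilon> / d"
      using yz by (intro \<eta>(2)) blast+
    moreover have "?a - ?b = (1 / d) *\<^sub>R (z - y)"
      by (simp add: algebra_simps)
    ultimately show "N (y - z) < \<epsilon>"
      using pos by (simp add: norm_fun_scaleR norm_fun_minus_commute[of y] divide_less_cancel)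
  qed
qed

text \<open>Taking the distance of two distinct nearest points as \<open>\<epsilon>\<close> makes
  that distance smaller than itself.\<close>

lemma nearest_point_unique:
  assumes uc: "uniformly_convex N" and K: "convex K"
    and y: "y \<in> K" "\<And>z. z \<in> K \<Longrightarrow> N (x - y) \<le> N (x - z)"
    and y': "y' \<in> K" "\<And>z. z \<in> K \<Longrightarrow> N (x - y') \<le> N (x - z)"
  shows "y = y'"
proof (rule ccontr)
  assume "y \<noteq> y'"
  then have "0 < N (y - y')"
    using norm_fun_nonneg[of "y - y'"] norm_fun_eq_0_iff[of "y - y'"] by simp
  then obtain \<eta> where "0 < \<eta>" and close: "\<And>w z. w \<in> K \<Longrightarrow> z \<in> K \<Longrightarrow>
      N (x - w) \<le> N (x - y) + \<eta> \<Longrightarrow> N (x - z) \<le> N (x - y) + \<eta> \<Longrightarrow> N (w - z) < N (y - y')"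
    using almost_nearest_points_close[OF uc K _ norm_fun_nonneg y(2)] by metis
  have "N (y - y') < N (y - y')"
    using close[OF y(1) y'(1)] y'(2)[OF y(1)] \<open>0 < \<eta>\<close> by simp
  then show False
    by simp
qed

text \<open>A minimizing sequence is Cauchy by closeness of almost nearest points. Its limit lies in
  the closed set \<open>K\<close> and attains the infimum.\<close>

lemma nearest_point_exists:
  assumes banach: "banach_norm N" and uc: "uniformly_convex N"
    and K: "convex K" "norm_closed N K" "K \<noteq> {}"
  obtains y where "y \<in> K" "\<And>z. z \<in> K \<Longrightarrow> N (x - y) \<le> N (x - z)"
proof -
  interpret Metric_space UNIV "dist_of N"
    by (rule Metric_space_dist_of)
  define d where "d = (INF z\<in>K. N (x - z))"
  have bdd: "bdd_below ((\<lambda>z. N (x - z)) ` K)"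
    by (intro bdd_belowI2[of _ 0] norm_fun_nonneg)
  have d_le: "d \<le> N (x - z)" if "z \<in> K" for z
    unfolding d_def using bdd that by (rule cINF_lower)
  have d_nonneg: "0 \<le> d"
    unfolding d_def using K(3) by (intro cINF_greatest norm_fun_nonneg)
  have "\<exists>z\<in>K. N (x - z) < d + 1 / Suc n" for n
    using cINF_less_iff[OF K(3) bdd, of "d + 1 / Suc n"] by (simp add: d_def)
  then obtain \<sigma> where \<sigma>: "\<And>n. \<sigma> n \<in> K" "\<And>n. N (x - \<sigma> n) < d + 1 / Suc n"
    by metis
  have near: "\<exists>m. \<forall>n\<ge>m. N (x - \<sigma> n) \<le> d + \<eta>" if pos: "0 < \<eta>" for \<eta>
  proof -
    obtain m where m: "1 / real (Suc m) < \<eta>"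
      using nat_approx_posE[OF pos] by metis
    have "N (x - \<sigma> n) \<le> d + \<eta>" if "m \<le> n" for n
    proof -
      have "1 / real (Suc n) \<le> 1 / real (Suc m)"
        using that by (intro divide_left_mono) auto
      with \<sigma>(2)[of n] m show ?thesis
        by linarith
    qed
    then show ?thesis
      by blast
  qed
  have "MCauchy \<sigma>"
    unfolding MCauchy_def
  proof (intro conjI allI impI)
    fix \<epsilon> :: real assume "0 < \<epsilon>"
    then obtain \<eta> where "0 < \<eta>" and \<eta>: "\<And>y z. y \<in> K \<Longrightarrow> z \<in> K \<Longrightarrow>
        N (x - y) \<le> d + \<eta> \<Longrightarrow> N (x - z) \<le> d + \<eta> \<Longrightarrow> N (y - z) < \<epsilon>"
      using almost_nearest_points_close[OF uc K(1) _ d_nonneg d_le] by metis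
    then obtain m where "\<And>n. m \<le> n \<Longrightarrow> N (x - \<sigma> n) \<le> d + \<eta>"
      using near by blast
    then show "\<exists>m. \<forall>n n'. m \<le> n \<longrightarrow> m \<le> n' \<longrightarrow> dist_of N (\<sigma> n) (\<sigma> n') < \<epsilon>"
      using \<eta> \<sigma>(1) unfolding dist_of_def by blast
  qed simp
  then obtain y where y: "limitin mtopology \<sigma> y sequentially"
    using banach unfolding banach_norm_def mcomplete_def by blast
  then have "y \<in> K"
    using K(2) \<sigma>(1) unfolding norm_closed_def metric_closedin_iff_sequentially_closed by blast
  moreover have "N (x - y) \<le> d"
  proof (rule field_le_epsilon)
    fix \<epsilon> :: real assume "0 < \<epsilon>"
    then have half: "0 < \<epsilon> / 2"
      by simp
    then obtain m where m: "\<And>n. m \<le> n \<Longrightarrow> N (\<sigma> n - y) < \<epsilon> / 2"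
      using y unfolding limit_metric_sequentially dist_of_def by blast
    obtain m' where m': "\<And>n. m' \<le> n \<Longrightarrow> N (x - \<sigma> n) \<le> d + \<epsilon> / 2"
      using near[OF half] by blast
    show "N (x - y) \<le> d + \<epsilon>"
      using norm_fun_triangle_sub[of x y "\<sigma> (max m m')"] m[of "max m m'"] m'[of "max m m'"]
      by simp
  qed
  ultimately show ?thesis
    using that d_le by (meson order_trans)
qed

lemma metric_projection_eq_iff:
  assumes "banach_norm N" "uniformly_convex N" "convex K" "norm_closed N K" and v: "v \<in> K"
  shows "metric_projection N K x = v \<longleftrightarrow> (\<forall>z\<in>K. N (x - v) \<le> N (x - z))"
proof -
  obtain y where y: "y \<in> K" "\<And>z. z \<in> K \<Longrightarrow> N (x - y) \<le> N (x - z)"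
    using nearest_point_exists[OF assms(1-4), of x] v by auto
  have unique: "w = y" if "w \<in> K" "\<forall>z\<in>K. N (x - w) \<le> N (x - z)" for w
    using nearest_point_unique[OF assms(2,3)] that y by blast
  have "metric_projection N K x = y"
    unfolding metric_projection_def using y unique by (intro the_equality) blast+
  then show ?thesis
    using y unique v by blast
qed

end

section \<open>The space \<open>\<ell>\<^sup>4\<close> in finite dimension\<close>

definition l4_norm :: "real ^ 'n \<Rightarrow> real" where
  "l4_norm x = root 4 (\<Sum>i\<in>UNIV. (x $ i) ^ 4)"

lemma l4_norm_nonneg: "0 \<le> l4_norm x"
  by (simp add: l4_norm_def sum_nonneg)

lemma l4_norm_power: "l4_norm x ^ 4 = (\<Sum>i\<in>UNIV. (x $ i) ^ 4)"
  by (simp add: l4_norm_def sum_nonneg)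

lemma l4_norm_le_iff: "l4_norm x \<le> l4_norm y \<longleftrightarrow> (\<Sum>i\<in>UNIV. (x $ i) ^ 4) \<le> (\<Sum>i\<in>UNIV. (y $ i) ^ 4)"
  by (simp add: l4_norm_def)

lemma l4_norm_eq_0_iff: "l4_norm x = 0 \<longleftrightarrow> x = 0"
  by (simp add: l4_norm_def sum_nonneg_eq_0_iff vec_eq_iff)

lemma l4_norm_zero [simp]: "l4_norm 0 = 0"
  by (simp add: l4_norm_eq_0_iff)

lemma l4_norm_scaleR: "l4_norm (c *\<^sub>R x) = \<bar>c\<bar> * l4_norm x"
proof (rule power_eq_imp_eq_base[where n = 4])
  show "l4_norm (c *\<^sub>R x) ^ 4 = (\<bar>c\<bar> * l4_norm x) ^ 4"
    by (simp add: l4_norm_power power_mult_distrib sum_distrib_left)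
qed (simp_all add: l4_norm_nonneg)

text \<open>With \<open>a\<close> and \<open>b\<close> the two norms,
  \<open>(x + y) / (a + b)\<close> is the convex combination of \<open>x / a\<close> and
  \<open>y / b\<close> with weights \<open>a / (a + b)\<close> and \<open>b / (a + b)\<close>;
  convexity of the fourth power applies in each coordinate.\<close>

lemma l4_norm_triangle: "l4_norm (x + y) \<le> l4_norm x + l4_norm y"
proof (cases "x = 0 \<or> y = 0")
  case True
  then show ?thesis
    by (auto simp: l4_norm_nonneg)
next
  case False
  define a b where "a = l4_norm x" and "b = l4_norm y"
  have pos: "0 < a" "0 < b"
    using False l4_norm_nonneg l4_norm_eq_0_iff unfolding a_def b_def by (metis less_eq_real_def)+
  define u where "u = a / (a + b)"
  have u: "0 \<le> u" "0 \<le> 1 - u" "u / a = 1 / (a + b)" "(1 - u) / b = 1 / (a + b)"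
    using pos by (simp_all add: u_def diff_divide_eq_iff add_pos_pos)
  have "((x + y) $ i / (a + b)) ^ 4 \<le> u * (x $ i / a) ^ 4 + (1 - u) * (y $ i / b) ^ 4" for i
  proof -
    have "(x + y) $ i / (a + b) = u / a * x $ i + (1 - u) / b * y $ i"
      by (simp add: u add_divide_distrib)
    then have "(x + y) $ i / (a + b) = u *\<^sub>R (x $ i / a) + (1 - u) *\<^sub>R (y $ i / b)"
      by simp
    moreover have "convex_on UNIV (\<lambda>t::real. t ^ 4)"
      by (rule convex_power_even) simp
    ultimately show ?thesis
      using convex_onD[of UNIV "\<lambda>t::real. t ^ 4" "1 - u" "x $ i / a" "y $ i / b"] u by simp
  qed
  then have "(\<Sum>i\<in>UNIV. ((x + y) $ i / (a + b)) ^ 4)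
      \<le> (\<Sum>i\<in>UNIV. u * (x $ i / a) ^ 4 + (1 - u) * (y $ i / b) ^ 4)"
    by (rule sum_mono)
  also have "\<dots> = u * (l4_norm x ^ 4 / a ^ 4) + (1 - u) * (l4_norm y ^ 4 / b ^ 4)"
    by (simp add: sum.distrib l4_norm_power power_divide flip: sum_distrib_left sum_divide_distrib)
  also have "\<dots> = 1"
    using pos by (simp flip: a_def b_def)
  finally have "l4_norm (x + y) ^ 4 / (a + b) ^ 4 \<le> 1"
    by (simp add: power_divide l4_norm_power flip: sum_divide_distrib)
  then have "l4_norm (x + y) ^ 4 \<le> (a + b) ^ 4"
    using pos by (simp add: divide_le_eq)
  then show ?thesis
    using pos power_mono_iff[of "l4_norm (x + y)" "a + b" 4] by (simp add: l4_norm_nonneg a_def b_def)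
qed

lemma norm_fun_l4_norm: "norm_fun l4_norm"
  by (simp add: norm_fun_def l4_norm_eq_0_iff l4_norm_triangle l4_norm_scaleR)

lemma continuous_on_l4_norm: "continuous_on S l4_norm"
  unfolding l4_norm_def[abs_def] by (intro continuous_intros)

text \<open>A crude constant suffices: the comparison transfers Cauchy sequences and boundedness to
  the Euclidean norm.\<close>

lemma norm_le_l4_norm:
  fixes x :: "real ^ 'n"
  shows "norm x \<le> CARD('n) * l4_norm x"
proof -
  have "\<bar>x $ i\<bar> \<le> l4_norm x" for i
  proof -
    have "\<bar>x $ i\<bar> ^ 4 \<le> (\<Sum>i\<in>UNIV. (x $ i) ^ 4)"
      using member_le_sum[of i UNIV "\<lambda>i. (x $ i) ^ 4"] by simp
    then have "\<bar>x $ i\<bar> ^ 4 \<le> l4_norm x ^ 4"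
      by (simp add: l4_norm_power)
    then show ?thesis
      using power_mono_iff[of "\<bar>x $ i\<bar>" "l4_norm x" 4] by (simp add: l4_norm_nonneg)
  qed
  then have "(\<Sum>i\<in>UNIV. \<bar>x $ i\<bar>) \<le> CARD('n) * l4_norm x"
    by (intro sum_bounded_above)
  then show ?thesis
    using norm_le_l1_cart[of x] by simp
qed

text \<open>Cauchy sequences are Euclidean Cauchy, and continuity of \<open>l4_norm\<close> at 0
  turns the Euclidean limit into a limit for \<open>l4_norm\<close>.\<close>

lemma banach_norm_l4_norm: "banach_norm (l4_norm :: real ^ 'n \<Rightarrow> real)"
proof -
  interpret Metric_space UNIV "dist_of (l4_norm :: real ^ 'n \<Rightarrow> real)"
    by (rule Metric_space_dist_of[OF norm_fun_l4_norm])
  have "mcomplete"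
    unfolding mcomplete_def
  proof (intro allI impI)
    fix \<sigma> assume \<sigma>: "MCauchy \<sigma>"
    have "Cauchy \<sigma>"
    proof (rule metric_CauchyI)
      fix e :: real assume "0 < e"
      then have "0 < e / CARD('n)"
        by simp
      then obtain m where m: "\<And>k n. m \<le> k \<Longrightarrow> m \<le> n \<Longrightarrow> l4_norm (\<sigma> k - \<sigma> n) < e / CARD('n)"
        using \<sigma> unfolding MCauchy_def dist_of_def by blast
      have "dist (\<sigma> k) (\<sigma> n) < e" if "m \<le> k" "m \<le> n" for k n
      proof -
        have "CARD('n) * l4_norm (\<sigma> k - \<sigma> n) < e"
          using m[OF that] by (simp add: field_simps)
        then show ?thesis
          using norm_le_l4_norm[of "\<sigma> k - \<sigma> n"] by (simp add: dist_norm)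
      qed
      then show "\<exists>M. \<forall>m\<ge>M. \<forall>n\<ge>M. dist (\<sigma> m) (\<sigma> n) < e"
        by blast
    qed
    then obtain y where "\<sigma> \<longlonglongrightarrow> y"
      by (metis Cauchy_convergent_iff convergent_def)
    then have "(\<lambda>n. \<sigma> n - y) \<longlonglongrightarrow> 0"
      by (simp add: LIM_zero_iff)
    moreover have "isCont (l4_norm :: real ^ 'n \<Rightarrow> real) 0"
      using continuous_on_l4_norm[of "UNIV :: (real ^ 'n) set"] by (simp add: continuous_on_eq_continuous_at)
    ultimately have "(\<lambda>n. l4_norm (\<sigma> n - y)) \<longlonglongrightarrow> l4_norm (0 :: real ^ 'n)"
      by (rule isCont_tendsto_compose[rotated])
    then have "(\<lambda>n. l4_norm (\<sigma> n - y)) \<longlonglongrightarrow> 0"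
      by simp
    then have "limitin mtopology \<sigma> y sequentially"
      unfolding limit_metric_sequentially dist_of_def
      by (simp add: LIMSEQ_def l4_norm_nonneg)
    then show "\<exists>y. limitin mtopology \<sigma> y sequentially" ..
  qed
  then show ?thesis
    by (simp add: banach_norm_def norm_fun_l4_norm)
qed

text \<open>The polynomial \<open>\<parallel>x + t h\<parallel>\<^sup>4 - (f (x + t h))\<^sup>4\<close> in \<open>t\<close> is nonnegative and vanishes at \<open>0\<close>, hence so
  does its derivative.\<close>

lemma l4_norming_functional:
  fixes f :: "real ^ 'n \<Rightarrow> real"
  assumes f: "linear f" "\<And>y. \<bar>f y\<bar> \<le> l4_norm y" and x: "f x = 1" "l4_norm x = 1"
  shows "f h = (\<Sum>i\<in>UNIV. (x $ i) ^ 3 * h $ i)"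
proof -
  define \<phi> where "\<phi> t = (\<Sum>i\<in>UNIV. (x $ i + t * h $ i) ^ 4) - (1 + t * f h) ^ 4" for t
  have "\<phi> 0 \<le> \<phi> t" for t
  proof -
    have "\<bar>f (x + t *\<^sub>R h)\<bar> ^ 4 \<le> l4_norm (x + t *\<^sub>R h) ^ 4"
      by (intro power_mono f) simp
    then have "(1 + t * f h) ^ 4 \<le> (\<Sum>i\<in>UNIV. (x $ i + t * h $ i) ^ 4)"
      by (simp add: l4_norm_power linear_add[OF f(1)] linear_scale[OF f(1)] x)
    moreover have "(\<Sum>i\<in>UNIV. (x $ i) ^ 4) = 1"
      using x(2) l4_norm_power[of x] by simp
    ultimately show ?thesis
      by (simp add: \<phi>_def)
  qed
  moreover have "(\<phi> has_real_derivative (4 * (\<Sum>i\<in>UNIV. (x $ i) ^ 3 * h $ i) - 4 * f h)) (at 0)"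
    unfolding \<phi>_def[abs_def]
    by (auto intro!: derivative_eq_intros simp: sum_distrib_left algebra_simps)
  ultimately have "4 * (\<Sum>i\<in>UNIV. (x $ i) ^ 3 * h $ i) - 4 * f h = 0"
    by (intro DERIV_local_min[of \<phi> _ 0 1]) auto
  then show ?thesis
    by simp
qed

section \<open>Strict convexity of the dual\<close>

text \<open>The unit ball is compact in finite dimension; replacing \<open>x\<close> by
  \<open>- x\<close> removes the absolute value.\<close>

lemma dual_norm_l4_attained:
  fixes f :: "real ^ 'n \<Rightarrow> real"
  assumes f: "linear f"
  obtains x where "l4_norm x \<le> 1" "f x = dual_norm l4_norm f"
proof -
  let ?B = "{x :: real ^ 'n. l4_norm x \<le> 1}"
  have "bounded ?B"
  proof (rule boundedI)
    fix x :: "real ^ 'n" assume "x \<in> ?B"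
    then have "CARD('n) * l4_norm x \<le> real CARD('n) * 1"
      by (intro mult_left_mono) auto
    then show "norm x \<le> CARD('n)"
      using norm_le_l4_norm[of x] by linarith
  qed
  moreover have "closed ?B"
    by (intro closed_Collect_le continuous_on_l4_norm continuous_on_const)
  ultimately have compact: "compact ?B"
    by (simp add: compact_eq_bounded_closed)
  have ne: "?B \<noteq> {}"
    by (auto intro!: exI[of _ 0])
  have "continuous_on ?B (\<lambda>x. \<bar>f x\<bar>)"
    using f by (intro continuous_on_rabs linear_continuous_on) (simp add: linear_conv_bounded_linear)
  then obtain x where x: "x \<in> ?B" "\<And>y. y \<in> ?B \<Longrightarrow> \<bar>f y\<bar> \<le> \<bar>f x\<bar>"
    using continuous_attains_sup[OF compact ne] by metis
  have eq: "dual_norm l4_norm f = \<bar>f x\<bar>"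
    unfolding dual_norm_def using x by (intro cSup_eq_maximum) auto
  have "l4_norm (- x) \<le> 1"
    using x(1) l4_norm_scaleR[of "-1" x] by simp
  with x(1) that[of x] that[of "- x"] eq linear_neg[OF f, of x] show ?thesis
    by (cases "0 \<le> f x") auto
qed

text \<open>If the midpoint had norm at least 1, both functionals would take the value 1 at a unit
  vector attaining its norm. That vector determines them by \<open>l4_norming_functional\<close>, so
  they would coincide.\<close>

lemma strictly_convex_dual_l4_norm: "strictly_convex_dual (l4_norm :: real ^ 'n \<Rightarrow> real)"
  unfolding strictly_convex_dual_def
proof (intro ballI impI, elim conjE)
  fix f g :: "real ^ 'n \<Rightarrow> real"
  assume mem: "f \<in> dual_space l4_norm" "g \<in> dual_space l4_norm"
    and one: "dual_norm l4_norm f = 1" "dual_norm l4_norm g = 1" and "f \<noteq> g"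
  have lin: "linear f" "linear g"
    using mem by (simp_all add: dual_space_def)
  have le: "\<bar>f y\<bar> \<le> l4_norm y" "\<bar>g y\<bar> \<le> l4_norm y" for y
    using dual_norm_bound[OF norm_fun_l4_norm mem(1), of y]
      dual_norm_bound[OF norm_fun_l4_norm mem(2), of y] one by simp_all
  let ?h = "\<lambda>x. (f x + g x) / 2"
  have "linear ?h"
    using lin by (intro linearI) (simp_all add: linear_add linear_scale field_simps)
  then obtain x where x: "l4_norm x \<le> 1" "?h x = dual_norm l4_norm ?h"
    by (rule dual_norm_l4_attained)
  show "dual_norm l4_norm ?h < 1"
  proof (rule ccontr)
    assume "\<not> dual_norm l4_norm ?h < 1"
    with x le[of x] have "f x = 1" "g x = 1" "l4_norm x = 1"
      by argo+
    with lin le have "f h = g h" for h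
      using l4_norming_functional[of f x h] l4_norming_functional[of g x h] by simp
    then have "f = g" ..
    with \<open>f \<noteq> g\<close> show False ..
  qed
qed

section \<open>A ray with a nonconvex dual cone\<close>

definition diagonal_ray :: "(real ^ 3) set" where
  "diagonal_ray = {vector [s, s, s] | s. 0 \<le> s}"

lemma cone_with_vertex_diagonal_ray: "cone_with_vertex 0 diagonal_ray"
  unfolding cone_with_vertex_def
proof (intro conjI ballI allI impI)
  show "0 \<in> diagonal_ray"
    unfolding diagonal_ray_def by (force simp: vec_eq_iff forall_3)
  fix x and t :: real assume "x \<in> diagonal_ray" "0 \<le> t"
  then obtain s where "x = vector [s, s, s]" "0 \<le> s"
    by (auto simp: diagonal_ray_def)
  with \<open>0 \<le> t\<close> show "0 + t *\<^sub>R (x - 0) \<in> diagonal_ray"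
    unfolding diagonal_ray_def
    by (intro CollectI exI[of _ "t * s"]) (simp add: vec_eq_iff forall_3)
qed

lemma mem_dual_cone_diagonal_ray_iff:
  "vector [a, b, c] \<in> dual_cone l4_norm 0 diagonal_ray \<longleftrightarrow>
     (\<forall>s\<ge>0. a ^ 4 + b ^ 4 + c ^ 4 \<le> (a - s) ^ 4 + (b - s) ^ 4 + (c - s) ^ 4)"
  unfolding dual_cone_eq_nearest[OF norm_fun_l4_norm strictly_convex_dual_l4_norm
      cone_with_vertex_diagonal_ray]
  by (auto simp: diagonal_ray_def l4_norm_le_iff sum_3)

text \<open>The points \<open>(-1, 0, 1)\<close> and \<open>(0, -1, 1)\<close> have coordinate cubes
  summing to 0, while for their midpoint \<open>(-1/2, -1/2, 1)\<close> the cubes sum to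
  \<open>3/4 > 0\<close>.\<close>

lemma not_convex_dual_cone_diagonal_ray: "\<not> convex (dual_cone l4_norm 0 diagonal_ray)"
proof
  let ?D = "dual_cone l4_norm 0 diagonal_ray"
  assume "convex ?D"
  have poly: "2 \<le> (1 + s) ^ 4 + s ^ 4 + (1 - s) ^ 4" for s :: real
  proof -
    have "(1 + s) ^ 4 + s ^ 4 + (1 - s) ^ 4 = 2 + 12 * s\<^sup>2 + 3 * (s\<^sup>2)\<^sup>2"
      by algebra
    moreover have "0 \<le> 12 * s\<^sup>2 + 3 * (s\<^sup>2)\<^sup>2"
      by simp
    ultimately show ?thesis
      by linarith
  qed
  have "(- 1 - s) ^ 4 = (1 + s) ^ 4" for s :: real
    by algebra
  with poly have "vector [-1, 0, 1] \<in> ?D" "vector [0, -1, 1] \<in> ?D"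
    by (simp_all add: mem_dual_cone_diagonal_ray_iff add.commute add.left_commute)
  with \<open>convex ?D\<close> have "(1/2) *\<^sub>R vector [-1, 0, 1] + (1/2) *\<^sub>R vector [0, -1, 1] \<in> ?D"
    by (rule convexD) simp_all
  also have "(1/2) *\<^sub>R vector [-1, 0, 1] + (1/2) *\<^sub>R vector [0, -1, 1] = (vector [-1/2, -1/2, 1] :: real ^ 3)"
    by (simp add: vec_eq_iff forall_3)
  finally show False
    unfolding mem_dual_cone_diagonal_ray_iff
    \<comment> \<open>At \<open>s = 1/4\<close> all three coordinates have absolute value
      \<open>3/4\<close>, and \<open>243/256 < 9/8\<close>.\<close>
    by (auto dest!: spec[of _ "1/4"] simp: power_divide)
qed

text \<open>The cubes of \<open>(2, 2, -3)\<close> sum to \<open>-11\<close>, which puts it in the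
  dual cone, but its coordinates sum to 1. Hence a short step from 0 towards it comes closer to
  \<open>(1, 1, 1)\<close>.\<close>

lemma diagonal_ray_not_subset_bidual:
  "\<not> diagonal_ray \<subseteq> dual_cone l4_norm 0 (dual_cone l4_norm 0 diagonal_ray)"
proof
  let ?D = "dual_cone l4_norm 0 diagonal_ray"
  let ?x = "vector [2, 2, -3] :: real ^ 3" and ?e = "vector [1, 1, 1] :: real ^ 3"
  assume "diagonal_ray \<subseteq> dual_cone l4_norm 0 ?D"
  moreover have "?e \<in> diagonal_ray"
    unfolding diagonal_ray_def by (intro CollectI exI[of _ 1]) simp
  ultimately have e: "?e \<in> dual_cone l4_norm 0 ?D"
    by blast
  have D: "cone_with_vertex 0 ?D"
    by (intro cone_with_vertex_dual_cone norm_fun_l4_norm strictly_convex_dual_l4_norm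
        cone_with_vertex_diagonal_ray)
  have "?x \<in> ?D"
    unfolding mem_dual_cone_diagonal_ray_iff
  proof (intro allI impI)
    fix s :: real assume "0 \<le> s"
    \<comment> \<open>The linear coefficient 44 is \<open>-4\<close> times the sum of cubes;
      completing a square makes the higher terms visibly nonnegative.\<close>
    have "(2 - s) ^ 4 + (2 - s) ^ 4 + (-3 - s) ^ 4 =
        113 + 44 * s + s\<^sup>2 * ((s - 2)\<^sup>2 + 2 * s\<^sup>2 + 98)"
      by algebra
    moreover have "0 \<le> s\<^sup>2 * ((s - 2)\<^sup>2 + 2 * s\<^sup>2 + 98)"
      by simp
    ultimately show "2 ^ 4 + 2 ^ 4 + (-3) ^ 4 \<le> (2 - s) ^ 4 + (2 - s) ^ 4 + (-3 - s) ^ 4"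
      using \<open>0 \<le> s\<close> by simp
  qed
  \<comment> \<open>The factor \<open>1/100\<close> is small enough for the first-order decrease to
    dominate: \<open>2 * 0.98^4 + 1.03^4 < 3\<close>.\<close>
  with D have "0 + (1/100) *\<^sub>R (?x - 0) \<in> ?D"
    unfolding cone_with_vertex_def by (metis zero_le_divide_1_iff zero_le_numeral)
  with e D have "l4_norm (?e - 0) \<le> l4_norm (?e - (0 + (1/100) *\<^sub>R (?x - 0)))"
    using dual_cone_eq_nearest[OF norm_fun_l4_norm strictly_convex_dual_l4_norm] by blast
  then show False
    by (simp add: l4_norm_le_iff sum_3 power_divide)
qed

theorem theorem3p2:
  shows
    "(\<forall>(N :: 'a::real_vector \<Rightarrow> real) K v.
        banach_norm N \<and> strictly_convex_dual N \<and> cone_with_vertex v K \<longrightarrow>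
          cone_with_vertex v (dual_cone N v K) \<and>
          (uniformly_convex N \<and> uniformly_smooth N \<longrightarrow> norm_closed N (dual_cone N v K)) \<and>
          (uniformly_convex N \<and> uniformly_smooth N \<and> norm_closed N K \<and> convex K \<longrightarrow>
             dual_cone N v K = {x. metric_projection N K x = v})) \<and>
     (\<exists>(N :: real^3 \<Rightarrow> real) K v.
        banach_norm N \<and> strictly_convex_dual N \<and> cone_with_vertex v K \<and>
        \<not> convex (dual_cone N v K) \<and>
        \<not> K \<subseteq> dual_cone N v (dual_cone N v K) \<and>
        K \<noteq> dual_cone N v (dual_cone N v K))"
proof (intro conjI allI impI; (elim conjE)?)
  fix N :: "'a \<Rightarrow> real" and K :: "'a set" and v :: 'a
  assume banach: "banach_norm N" and scd: "strictly_convex_dual N" and K: "cone_with_vertex v K"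
  then have N: "norm_fun N"
    by (simp add: banach_norm_def)
  show "cone_with_vertex v (dual_cone N v K)"
    using N scd K by (rule cone_with_vertex_dual_cone)
  show "norm_closed N (dual_cone N v K)"
    using N scd K by (rule norm_closed_dual_cone)
  have v: "v \<in> K"
    using K by (simp add: cone_with_vertex_def)
  show "dual_cone N v K = {x. metric_projection N K x = v}"
    if "uniformly_convex N" "norm_closed N K" "convex K"
    using metric_projection_eq_iff[OF N banach that(1,3,2) v]
    by (simp add: dual_cone_eq_nearest[OF N scd K])
next
  \<comment> \<open>One ray serves all three failures; the inequality of the sets follows from the
    failed inclusion.\<close>
  show "\<exists>(N :: real^3 \<Rightarrow> real) K v.
        banach_norm N \<and> strictly_convex_dual N \<and> cone_with_vertex v K \<and>
        \<not> convex (dual_cone N v K) \<and>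
        \<not> K \<subseteq> dual_cone N v (dual_cone N v K) \<and>
        K \<noteq> dual_cone N v (dual_cone N v K)"
    using banach_norm_l4_norm strictly_convex_dual_l4_norm cone_with_vertex_diagonal_ray
      not_convex_dual_cone_diagonal_ray diagonal_ray_not_subset_bidual by blast
qed

end
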